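(* Let $x\in\mathbb{R}^n$ be a block $K$-sparse signal over $\mathcal{I}=\{d_1,\dots,d_l\}$, let $A\in\mathbb{R}^{m\times n}$, and let $N\ge 1$ be an integer with $N\le K$ and $N\le \frac{m}{K}$. Suppose that $A$ satisfies the block-RIP of order $NK+1$ with block-RIC $\delta_{NK+1}$ fulfilling $$\delta_{NK+1}<\frac{1}{\sqrt{\frac{K}{N}+1}}.$$ Then the BOMMP algorithm (with input $y$, $A$, $K$, $N$ and stopping tolerance $\epsilon=0$) recovers the block sparse signal $x$ exactly from $y=Ax$, i.e. its output satisfies $\hat{x}=x$.
   Context: Block structure. Fix positive integers $d_1,\dots,d_l$ with $n=\sum_{i=1}^l d_i$ and write $\mathcal{I}=\{d_1,\dots,d_l\}$. A vector $x\in\mathbb{R}^n$ is viewed as a concatenation of consecutive blocks $x[1],\dots,x[l]$ with $x[i]\in\mathbb{R}^{d_i}$; a matrix $A\in\mathbb{R}^{m\times n}$ is correspondingly a concatenation of column blocks $A[1],\dots,A[l]$ with $A[i]\in\mathbb{R}^{m\times d_i}$. The block support of $x$ is $T=\text{block-supp}(x)=\{i:\|x[i]\|_2>0\}$, and $x$ is block $K$-sparse if $|T|\le K$. For $\Gamma\subseteq\{1,\dots,l\}$, $A_\Gamma$ is the submatrix of $A$ formed by the column blocks $A[i]$, $i\in\Gamma$. The prime denotes transpose. Block-RIP. $A$ satisfies the block-RIP of order $K$ if there is $\delta\in[0,1)$ with $(1-\delta)\|x\|_2^2\le\|Ax\|_2^2\le(1+\delta)\|x\|_2^2$ for all block $K$-sparse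 $x$ over $\mathcal{I}$; the smallest such $\delta$ is the block restricted isometry constant (block-RIC) $\delta_K=\delta_{K|\mathcal{I}}$. BOMMP (block orthogonal multi-matching pursuit) algorithm. Input: $y\in\mathbb{R}^m$, $A\in\mathbb{R}^{m\times n}$, block sparsity level $K$, number $N$ of indices per selection ($1\le N\le K$, $N\le m/K$, $N\le l$), tolerance $\epsilon\ge 0$. Initialize $k=0$, $r^0=y$, $\Lambda^0=\varnothing$. While $\|r^k\|_2>\epsilon$ and $k<\min\{K,\frac{m}{N}\}$, set $k=k+1$ and perform: (identification) let $T^k$ be a set of $N$ block indices corresponding to the $N$ largest values of $\|A'[i]r^{k-1}\|_2$, $i=1,\dots,l$, where $A'[i]=(A[i])'$ (ties broken arbitrarily); (augmentation) $\Lambda^k=\Lambda^{k-1}\cup T^k$; (estimation) $\hat{x}_{\Lambda^k}=\arg\min_u\|y-A_{\Lambda^k}u\|_2$; (residual update) $r^k=y-A_{\Lambda^k}\hat{x}_{\Lambda^k}$. Output: $\hat{x}=\arg\min_{u}\|y-Au\|_2$ over $u\in\mathbb{R}^n$ whose block support is contained in the final $\Lambda^k$. *)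

theory Defs
  imports
    "HOL-Analysis.L2_Norm"
    "Jordan_Normal_Form.Matrix"
    "Jordan_Normal_Form.DL_Submatrix"
begin

text \<open>
  A block structure is the list \<open>d = [d\<^sub>1, \<dots>, d\<^sub>l]\<close> of block lengths, so \<open>l = length d\<close> and
  \<open>n = sum_list d\<close>. Blocks and coordinates are numbered from 0.
\<close>

definition vec_l2 :: "real vec \<Rightarrow> real" where
  "vec_l2 v = L2_set (\<lambda>i. v $ i) {..<dim_vec v}"

definition block_offset :: "nat list \<Rightarrow> nat \<Rightarrow> nat" where
  "block_offset d i = sum_list (take i d)"

definition block_range :: "nat list \<Rightarrow> nat \<Rightarrow> nat set" where
  "block_range d i = {block_offset d i ..< block_offset d i + d ! i}"

definition vec_block :: "nat list \<Rightarrow> real vec \<Rightarrow> nat \<Rightarrow> real vec" where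
  "vec_block d x i = vec (d ! i) (\<lambda>j. x $ (block_offset d i + j))"

definition block_supp :: "nat list \<Rightarrow> real vec \<Rightarrow> nat set" where
  "block_supp d x = {i. i < length d \<and> vec_l2 (vec_block d x i) > 0}"

definition block_sparse :: "nat list \<Rightarrow> nat \<Rightarrow> real vec \<Rightarrow> bool" where
  "block_sparse d K x \<longleftrightarrow> card (block_supp d x) \<le> K"

definition mat_blocks :: "nat list \<Rightarrow> real mat \<Rightarrow> nat set \<Rightarrow> real mat" where
  "mat_blocks d A \<Gamma> = submatrix A UNIV (\<Union>i\<in>\<Gamma>. block_range d i)"

abbreviation mat_block :: "nat list \<Rightarrow> real mat \<Rightarrow> nat \<Rightarrow> real mat" where
  "mat_block d A i \<equiv> mat_blocks d A {i}"

definition block_RIP_bound :: "nat list \<Rightarrow> real mat \<Rightarrow> nat \<Rightarrow> real \<Rightarrow> bool" where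
  "block_RIP_bound d A K \<delta> \<longleftrightarrow> 0 \<le> \<delta> \<and> \<delta> < 1 \<and>
     (\<forall>x \<in> carrier_vec (sum_list d). block_sparse d K x \<longrightarrow>
        (1 - \<delta>) * (vec_l2 x)\<^sup>2 \<le> (vec_l2 (A *\<^sub>v x))\<^sup>2 \<and>
        (vec_l2 (A *\<^sub>v x))\<^sup>2 \<le> (1 + \<delta>) * (vec_l2 x)\<^sup>2)"

definition block_RIP :: "nat list \<Rightarrow> real mat \<Rightarrow> nat \<Rightarrow> bool" where
  "block_RIP d A K \<longleftrightarrow> (\<exists>\<delta>. block_RIP_bound d A K \<delta>)"

text \<open>Meaningful only if \<^term>\<open>block_RIP d A K\<close> holds; the minimum is then attained.\<close>

definition block_RIC :: "nat list \<Rightarrow> real mat \<Rightarrow> nat \<Rightarrow> real" where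
  "block_RIC d A K = (LEAST \<delta>. block_RIP_bound d A K \<delta>)"

text \<open>
  BOMMP leaves the choice among ties open, so it is modelled as a nondeterministic transition
  system: \<open>largest_blocks\<close> holds for every admissible selection \<open>T\<close> of \<open>N\<close> block indices.
\<close>

definition largest_blocks :: "nat list \<Rightarrow> real mat \<Rightarrow> nat \<Rightarrow> real vec \<Rightarrow> nat set \<Rightarrow> bool" where
  "largest_blocks d A N r T \<longleftrightarrow> T \<subseteq> {..<length d} \<and> card T = N \<and>
     (\<forall>i \<in> T. \<forall>j \<in> {..<length d} - T.
        vec_l2 (transpose_mat (mat_block d A j) *\<^sub>v r) \<le>
        vec_l2 (transpose_mat (mat_block d A i) *\<^sub>v r))"

definition bommp_continue ::
    "real mat \<Rightarrow> nat \<Rightarrow> nat \<Rightarrow> real \<Rightarrow> nat \<Rightarrow> real vec \<Rightarrow> bool" where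
  "bommp_continue A K N \<epsilon> k r \<longleftrightarrow>
     vec_l2 r > \<epsilon> \<and> real k < min (real K) (real (dim_row A) / real N)"

text \<open>
  \<open>bommp_state d A y K N \<epsilon> k \<Lambda> r\<close>: some run reaches, after \<open>k\<close> iterations, the index set \<open>\<Lambda>\<close> and
  the residual \<open>r\<close>.
\<close>

inductive bommp_state ::
    "nat list \<Rightarrow> real mat \<Rightarrow> real vec \<Rightarrow> nat \<Rightarrow> nat \<Rightarrow> real \<Rightarrow> nat \<Rightarrow> nat set \<Rightarrow> real vec \<Rightarrow> bool"
  for d :: "nat list" and A :: "real mat" and y :: "real vec" and K N :: nat and \<epsilon> :: real
where
  init: "bommp_state d A y K N \<epsilon> 0 {} y"
| step: "\<lbrakk> bommp_state d A y K N \<epsilon> k \<Lambda> r;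
           bommp_continue A K N \<epsilon> k r;
           largest_blocks d A N r T;
           \<Lambda>' = \<Lambda> \<union> T;
           is_arg_min (\<lambda>u. vec_l2 (y - mat_blocks d A \<Lambda>' *\<^sub>v u))
             (\<lambda>u. u \<in> carrier_vec (dim_col (mat_blocks d A \<Lambda>'))) z;
           r' = y - mat_blocks d A \<Lambda>' *\<^sub>v z \<rbrakk>
         \<Longrightarrow> bommp_state d A y K N \<epsilon> (Suc k) \<Lambda>' r'"

definition bommp_output ::
    "nat list \<Rightarrow> real mat \<Rightarrow> real vec \<Rightarrow> nat \<Rightarrow> nat \<Rightarrow> real \<Rightarrow> real vec \<Rightarrow> bool" where
  "bommp_output d A y K N \<epsilon> xhat \<longleftrightarrow>
     (\<exists>k \<Lambda> r. bommp_state d A y K N \<epsilon> k \<Lambda> r \<and> \<not> bommp_continue A K N \<epsilon> k r \<and>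
        is_arg_min (\<lambda>u. vec_l2 (y - A *\<^sub>v u))
          (\<lambda>u. u \<in> carrier_vec (sum_list d) \<and> block_supp d u \<subseteq> \<Lambda>) xhat)"

end

theory Submission
  imports Defs "Jordan_Normal_Form.Determinant"
begin

text \<open>
  Every iteration with a nonzero residual selects a new block of the support \<open>S\<close> of \<open>x\<close>. The residual
  is \<open>r = A z\<close> with \<open>z\<close> supported on \<open>S \<union> \<Lambda>\<close>, and \<open>g = A\<^sup>T r\<close> vanishes on \<open>\<Lambda>\<close> because the estimate
  solves a least squares problem. If the selected \<open>T\<close> missed \<open>S - \<Lambda>\<close>, then the restriction \<open>h\<close> of \<open>g\<close>
  to \<open>T\<close> would be orthogonal to \<open>z\<close>, and Cauchy-Schwarz together with the maximality of \<open>T\<close> would give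
  \<open>c \<parallel>r\<parallel>\<^sup>2 \<le> \<parallel>z\<parallel> \<parallel>h\<parallel>\<close> for \<open>c = sqrt (N / K)\<close>. Polarizing the block-RIP on the pair \<open>z\<close>,
  \<open>w = \<parallel>z\<parallel> h - c \<parallel>h\<parallel> z\<close> turns this into \<open>\<delta> \<ge> c / sqrt (1 + c\<^sup>2) = 1 / sqrt (K / N + 1)\<close>.
  At least one hit per iteration keeps the size of \<open>S \<union> \<Lambda> \<union> T\<close> at most \<open>N K + 1\<close>, so order \<open>N K + 1\<close>
  suffices throughout, and after at most \<open>K\<close> iterations \<open>S \<subseteq> \<Lambda>\<close>, where \<open>A\<close> is injective.
\<close>

section \<open>Least squares\<close>

lemma vec_l2_power2: "(vec_l2 v)\<^sup>2 = v \<bullet> v"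
  by (auto simp: vec_l2_def L2_set_def scalar_prod_def sum_nonneg power2_eq_square lessThan_atLeast0)

lemma vec_l2_nonneg [simp]: "0 \<le> vec_l2 v"
  by (simp add: vec_l2_def)

lemma vec_l2_zero [simp]: "vec_l2 (0\<^sub>v n) = 0"
  by (simp add: vec_l2_def L2_set_def)

lemma vec_l2_le_iff: "vec_l2 u \<le> vec_l2 v \<longleftrightarrow> u \<bullet> u \<le> v \<bullet> v"
  by (metis vec_l2_power2 vec_l2_nonneg power2_le_iff_abs_le abs_of_nonneg)

lemma scalar_prod_self_nonneg: "0 \<le> v \<bullet> (v :: real vec)"
  by (metis vec_l2_power2 zero_le_power2)

lemma scalar_prod_self_eq_0_iff:
  assumes "v \<in> carrier_vec n"
  shows "v \<bullet> v = (0::real) \<longleftrightarrow> v = 0\<^sub>v n"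
proof
  assume "v \<bullet> v = 0"
  then have "v $ i = 0" if "i < n" for i
    using assms that by (auto simp: scalar_prod_def sum_nonneg_eq_0_iff)
  with assms show "v = 0\<^sub>v n" by auto
qed (use assms in auto)

lemma scalar_prod_add_self:
  assumes "u \<in> carrier_vec n" "v \<in> carrier_vec n"
  shows "(u + v) \<bullet> (u + v) = u \<bullet> u + 2 * (u \<bullet> v) + v \<bullet> (v :: real vec)"
proof -
  have "(u + v) \<bullet> (u + v) = (\<Sum>i=0..<n. u $ i * u $ i + 2 * (u $ i * v $ i) + v $ i * v $ i)"
    using assms by (auto simp: scalar_prod_def algebra_simps intro!: sum.cong)
  then show ?thesis
    using assms by (simp add: scalar_prod_def sum.distrib sum_distrib_left)
qed

lemma scalar_prod_diff_self:
  assumes "u \<in> carrier_vec n" "v \<in> carrier_vec n"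
  shows "(u - v) \<bullet> (u - v) = u \<bullet> u - 2 * (u \<bullet> v) + v \<bullet> (v :: real vec)"
proof -
  have "(u - v) \<bullet> (u - v) = (\<Sum>i=0..<n. u $ i * u $ i - 2 * (u $ i * v $ i) + v $ i * v $ i)"
    using assms by (auto simp: scalar_prod_def algebra_simps intro!: sum.cong)
  then show ?thesis
    using assms by (simp add: scalar_prod_def sum.distrib sum_subtractf sum_distrib_left)
qed

text \<open>Cauchy-Schwarz, kept in squared form so that it combines directly with the other
  quadratic estimates.\<close>

lemma scalar_prod_power2_le:
  assumes "u \<in> carrier_vec n" "v \<in> carrier_vec n"
  shows "(u \<bullet> v)\<^sup>2 \<le> (u \<bullet> u) * (v \<bullet> (v :: real vec))"
proof -
  have "\<bar>u \<bullet> v\<bar> \<le> (\<Sum>i=0..<n. \<bar>u $ i\<bar> * \<bar>v $ i\<bar>)"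
    using assms by (auto simp: scalar_prod_def simp flip: abs_mult)
  also have "\<dots> \<le> vec_l2 u * vec_l2 v"
    using assms L2_set_mult_ineq[of "\<lambda>i. u $ i" "\<lambda>i. v $ i" "{0..<n}"]
    by (simp add: vec_l2_def lessThan_atLeast0)
  finally have "\<bar>u \<bullet> v\<bar>\<^sup>2 \<le> (vec_l2 u * vec_l2 v)\<^sup>2"
    by (intro power_mono) auto
  then show ?thesis by (simp add: power_mult_distrib vec_l2_power2)
qed

section \<open>Normal equations and solvability of least squares problems\<close>

lemma mult_mat_vec_scalar_prod:
  fixes A :: "real mat"
  assumes "A \<in> carrier_mat m n" "u \<in> carrier_vec n" "r \<in> carrier_vec m"
  shows "(A *\<^sub>v u) \<bullet> r = u \<bullet> (transpose_mat A *\<^sub>v r)"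
  using transpose_vec_mult_scalar[OF assms] assms
  by (metis comm_scalar_prod mult_mat_vec_carrier transpose_carrier_mat)

text \<open>Moving the minimizer by \<open>t\<close> along \<open>g\<close>, the negative gradient
  direction, changes the squared residual by
  \<open>- 2 * t * (g \<bullet> g) + t\<^sup>2 * q\<close>. For small positive \<open>t\<close> this
  is negative unless \<open>g\<close> vanishes.\<close>

lemma least_squares_normal_equation:
  fixes B :: "real mat"
  assumes B: "B \<in> carrier_mat m p" and y: "y \<in> carrier_vec m"
    and min: "is_arg_min (\<lambda>u. vec_l2 (y - B *\<^sub>v u)) (\<lambda>u. u \<in> carrier_vec p) z"
  shows "transpose_mat B *\<^sub>v (y - B *\<^sub>v z) = 0\<^sub>v p"
proof -
  have z: "z \<in> carrier_vec p"
    using min by (simp add: is_arg_min_linorder)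
  have le: "vec_l2 (y - B *\<^sub>v z) \<le> vec_l2 (y - B *\<^sub>v u)" if "u \<in> carrier_vec p" for u
    using min that by (simp add: is_arg_min_linorder)
  define r where "r = y - B *\<^sub>v z"
  define g where "g = transpose_mat B *\<^sub>v r"
  have r: "r \<in> carrier_vec m" and g: "g \<in> carrier_vec p"
    using B y z by (auto simp: r_def g_def)
  have Bg: "B *\<^sub>v g \<in> carrier_vec m" using B g by auto
  define q where "q = (B *\<^sub>v g) \<bullet> (B *\<^sub>v g)"
  have q: "q \<ge> 0" by (simp add: q_def scalar_prod_self_nonneg)
  have gr: "r \<bullet> (B *\<^sub>v g) = g \<bullet> g"
    using mult_mat_vec_scalar_prod[OF B g r] comm_scalar_prod[OF r Bg] by (simp add: g_def)
  \<comment> \<open>The exact line search would divide by \<open>q\<close>. Adding 1 avoids a zero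
    denominator when \<open>B *\<^sub>v g\<close> vanishes, and the resulting step is still short
    enough to decrease the residual.\<close>
  define t where "t = (g \<bullet> g) / (q + 1)"
  have "y - B *\<^sub>v (z + t \<cdot>\<^sub>v g) = r - t \<cdot>\<^sub>v (B *\<^sub>v g)"
    using B y z g Bg by (auto simp: r_def mult_add_distrib_mat_vec[OF B] mult_mat_vec[OF B])
  with le[of "z + t \<cdot>\<^sub>v g"] z g have "r \<bullet> r \<le> (r - t \<cdot>\<^sub>v (B *\<^sub>v g)) \<bullet> (r - t \<cdot>\<^sub>v (B *\<^sub>v g))"
    by (simp add: vec_l2_le_iff r_def)
  also have "\<dots> = r \<bullet> r - 2 * t * (g \<bullet> g) + t\<^sup>2 * q"
    using r Bg by (simp add: scalar_prod_diff_self[of _ m] gr q_def power2_eq_square)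
  finally have le': "2 * t * (g \<bullet> g) \<le> t\<^sup>2 * q" by simp
  have gg: "g \<bullet> g = t * (q + 1)" using q by (simp add: t_def)
  have "2 * t\<^sup>2 * (q + 1) \<le> t\<^sup>2 * q"
    using le' unfolding gg by (simp add: power2_eq_square algebra_simps)
  then have "t\<^sup>2 * (q + 2) \<le> 0" by (simp add: algebra_simps)
  then have "t = 0" using q by (simp add: mult_le_0_iff)
  then have "g \<bullet> g = 0" using gg by simp
  then show ?thesis using scalar_prod_self_eq_0_iff[OF g] by (simp add: g_def r_def)
qed

text \<open>For injective \<open>B\<close> the Gram matrix is invertible, because its quadratic form
  at \<open>v\<close> is the squared norm of \<open>B *\<^sub>v v\<close>. The normal equations then
  have a solution \<open>z\<close>, and its residual is orthogonal to the range of \<open>B\<close>,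
  so any other choice only adds a nonnegative term by Pythagoras.\<close>

lemma exists_least_squares:
  fixes B :: "real mat"
  assumes B: "B \<in> carrier_mat m p" and y: "y \<in> carrier_vec m"
    and inj: "\<And>u. u \<in> carrier_vec p \<Longrightarrow> B *\<^sub>v u = 0\<^sub>v m \<Longrightarrow> u = 0\<^sub>v p"
  obtains z where "is_arg_min (\<lambda>u. vec_l2 (y - B *\<^sub>v u)) (\<lambda>u. u \<in> carrier_vec p) z"
proof -
  let ?G = "transpose_mat B * B"
  have G: "?G \<in> carrier_mat p p" using B by auto
  have BT: "transpose_mat B \<in> carrier_mat p m" using B by auto
  have "v = 0\<^sub>v p" if v: "v \<in> carrier_vec p" and 0: "?G *\<^sub>v v = 0\<^sub>v p" for v
  proof -
    have Bv: "B *\<^sub>v v \<in> carrier_vec m" using B v by auto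
    have "(B *\<^sub>v v) \<bullet> (B *\<^sub>v v) = v \<bullet> (?G *\<^sub>v v)"
      using mult_mat_vec_scalar_prod[OF B v Bv] assoc_mult_mat_vec[OF BT B v] by simp
    with 0 v have "(B *\<^sub>v v) \<bullet> (B *\<^sub>v v) = 0" by simp
    then show ?thesis using scalar_prod_self_eq_0_iff[OF Bv] inj[OF v] by simp
  qed
  then have "det ?G \<noteq> 0" using det_0_iff_vec_prod_zero_field[OF G] by auto
  then obtain H where H: "H \<in> carrier_mat p p" and GH: "?G * H = 1\<^sub>m p"
    using det_non_zero_imp_unit[OF G, where b = "()"] by (auto simp: Units_def ring_mat_def)
  define z where "z = H *\<^sub>v (transpose_mat B *\<^sub>v y)"
  define r where "r = y - B *\<^sub>v z"
  have BTy: "transpose_mat B *\<^sub>v y \<in> carrier_vec p" using BT y by auto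
  have z: "z \<in> carrier_vec p" using H BTy by (auto simp: z_def)
  have r: "r \<in> carrier_vec m" using B y z by (auto simp: r_def)
  have Bz: "B *\<^sub>v z \<in> carrier_vec m" using B z by auto
  have "transpose_mat B *\<^sub>v (B *\<^sub>v z) = transpose_mat B *\<^sub>v y"
    using assoc_mult_mat_vec[OF BT B z] assoc_mult_mat_vec[OF G H BTy] GH BTy by (simp add: z_def)
  then have BTr: "transpose_mat B *\<^sub>v r = 0\<^sub>v p"
    using BT y Bz BTy by (simp add: r_def mult_minus_distrib_mat_vec[OF BT])
  have "vec_l2 r \<le> vec_l2 (y - B *\<^sub>v u)" if u: "u \<in> carrier_vec p" for u
  proof -
    have zu: "z - u \<in> carrier_vec p" using z u by auto
    have Bzu: "B *\<^sub>v (z - u) \<in> carrier_vec m" using B zu by auto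
    have Bu: "B *\<^sub>v u \<in> carrier_vec m" using B u by auto
    have eq: "y - B *\<^sub>v u = r + B *\<^sub>v (z - u)"
      using y Bz Bu by (auto simp: r_def mult_minus_distrib_mat_vec[OF B z u])
    have "r \<bullet> (B *\<^sub>v (z - u)) = 0"
      using mult_mat_vec_scalar_prod[OF B zu r] comm_scalar_prod[OF r Bzu] BTr zu by simp
    then show ?thesis
      unfolding vec_l2_le_iff eq scalar_prod_add_self[OF r Bzu]
      by (simp add: scalar_prod_self_nonneg)
  qed
  then have "is_arg_min (\<lambda>u. vec_l2 (y - B *\<^sub>v u)) (\<lambda>u. u \<in> carrier_vec p) z"
    using z by (auto simp: is_arg_min_linorder r_def)
  then show thesis by (rule that)
qed

section \<open>Block supports and column submatrices\<close>

definition block_indices :: "nat list \<Rightarrow> nat set \<Rightarrow> nat set" where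
  "block_indices d \<Gamma> = (\<Union>i\<in>\<Gamma>. block_range d i)"

text \<open>Entries are set to zero rather than deleted, so the result stays in the full space and
  can be multiplied by \<open>A\<close>.\<close>

definition block_restrict :: "nat list \<Rightarrow> nat set \<Rightarrow> real vec \<Rightarrow> real vec" where
  "block_restrict d \<Gamma> v = vec (dim_vec v) (\<lambda>j. if j \<in> block_indices d \<Gamma> then v $ j else 0)"

lemma dim_block_restrict [simp]: "dim_vec (block_restrict d \<Gamma> v) = dim_vec v"
  by (simp add: block_restrict_def)

lemma block_restrict_carrier [simp]:
  "block_restrict d \<Gamma> v \<in> carrier_vec n \<longleftrightarrow> v \<in> carrier_vec n"
  by (metis carrier_vecD carrier_vecI dim_block_restrict)

lemma index_block_restrict [simp]:
  "j < dim_vec v \<Longrightarrow> block_restrict d \<Gamma> v $ j = (if j \<in> block_indices d \<Gamma> then v $ j else 0)"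
  by (simp add: block_restrict_def)

lemma block_offset_Suc: "i < length d \<Longrightarrow> block_offset d (Suc i) = block_offset d i + d ! i"
  by (simp add: block_offset_def take_Suc_conv_app_nth)

lemma block_offset_mono:
  assumes "i \<le> j" "j \<le> length d"
  shows "block_offset d i \<le> block_offset d j"
proof -
  have "take j d = take i d @ drop i (take j d)"
    using assms by (metis append_take_drop_id min.absorb1 take_take)
  then have "sum_list (take j d) = sum_list (take i d) + sum_list (drop i (take j d))"
    by (metis sum_list_append)
  then show ?thesis by (simp add: block_offset_def)
qed

lemma block_range_disjoint:
  assumes "i < length d" "j < length d" "i \<noteq> j"
  shows "block_range d i \<inter> block_range d j = {}"
proof -
  have "block_range d i \<inter> block_range d j = {}" if "i < j" "j < length d" for i j
    using block_offset_mono[of "Suc i" j d] block_offset_Suc[of i d] that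
    by (auto simp: block_range_def)
  then show ?thesis using assms by (metis Int_commute linorder_neqE_nat)
qed

text \<open>Stated for initial segments of blocks so that induction applies, each step appending one
  adjacent interval. The case of all blocks assigns every coordinate to some block.\<close>

lemma block_indices_lessThan:
  "k \<le> length d \<Longrightarrow> block_indices d {..<k} = {..<block_offset d k}"
proof (induction k)
  case 0
  then show ?case by (simp add: block_indices_def block_offset_def)
next
  case (Suc k)
  then show ?case
    using block_offset_Suc[of k d]
    by (auto simp: block_indices_def block_range_def lessThan_Suc)
qed

lemma block_indices_all [simp]: "block_indices d {..<length d} = {..<sum_list d}"
  by (simp add: block_indices_lessThan) (simp add: block_offset_def)

lemma block_indices_subset:
  "\<Gamma> \<subseteq> {..<length d} \<Longrightarrow> block_indices d \<Gamma> \<subseteq> {..<sum_list d}"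
  using block_indices_all[of d] unfolding block_indices_def by blast

lemma finite_block_range [simp]: "finite (block_range d i)"
  by (simp add: block_range_def)

lemma block_range_subset: "i < length d \<Longrightarrow> block_range d i \<subseteq> {..<sum_list d}"
  using block_indices_subset[of "{i}" d] by (simp add: block_indices_def)

lemma block_indices_iff:
  assumes "\<Gamma> \<subseteq> {..<length d}" "i < length d" "j \<in> block_range d i"
  shows "j \<in> block_indices d \<Gamma> \<longleftrightarrow> i \<in> \<Gamma>"
  using assms block_range_disjoint[of i d] unfolding block_indices_def by blast

lemma sum_block_indices:
  assumes "\<Gamma> \<subseteq> {..<length d}"
  shows "sum f (block_indices d \<Gamma>) = (\<Sum>i\<in>\<Gamma>. sum f (block_range d i))"
  unfolding block_indices_def
  using assms block_range_disjoint[of _ d] finite_subset[OF assms]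
  by (intro sum.UNION_disjoint) (auto simp: subset_iff)

lemma vec_l2_vec_block_power2:
  "(vec_l2 (vec_block d v i))\<^sup>2 = (\<Sum>j\<in>block_range d i. (v $ j)\<^sup>2)"
proof -
  have "(vec_l2 (vec_block d v i))\<^sup>2 = (\<Sum>j<d ! i. (v $ (block_offset d i + j))\<^sup>2)"
    by (simp add: vec_l2_def L2_set_def sum_nonneg vec_block_def)
  also have "\<dots> = (\<Sum>j\<in>block_range d i. (v $ j)\<^sup>2)"
    by (rule sum.reindex_bij_witness[of _ "\<lambda>j. j - block_offset d i" "\<lambda>j. block_offset d i + j"])
       (auto simp: block_range_def)
  finally show ?thesis .
qed

lemma block_supp_iff:
  "i \<in> block_supp d v \<longleftrightarrow> i < length d \<and> (\<exists>j\<in>block_range d i. v $ j \<noteq> 0)"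
proof -
  have "vec_l2 (vec_block d v i) > 0 \<longleftrightarrow> (vec_l2 (vec_block d v i))\<^sup>2 \<noteq> 0"
    using vec_l2_nonneg[of "vec_block d v i"] by (simp add: order_less_le del: vec_l2_nonneg)
  also have "\<dots> \<longleftrightarrow> (\<exists>j\<in>block_range d i. v $ j \<noteq> 0)"
    unfolding vec_l2_vec_block_power2 by (subst sum_nonneg_eq_0_iff) auto
  finally show ?thesis by (simp add: block_supp_def)
qed

lemma block_supp_subset_lessThan: "block_supp d v \<subseteq> {..<length d}"
  by (auto simp: block_supp_def)

lemma finite_block_supp [simp]: "finite (block_supp d v)"
  using block_supp_subset_lessThan finite_subset by blast

text \<open>Replaces the norms in the definition of the support by vanishing coordinates. This
  condition is linear in \<open>v\<close>, which makes closure under sums, differences and multiples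
  immediate.\<close>

lemma block_supp_subset_iff:
  assumes "\<Gamma> \<subseteq> {..<length d}"
  shows "block_supp d v \<subseteq> \<Gamma> \<longleftrightarrow> (\<forall>j<sum_list d. j \<notin> block_indices d \<Gamma> \<longrightarrow> v $ j = 0)"
proof (intro iffI allI impI subsetI)
  fix j assume *: "block_supp d v \<subseteq> \<Gamma>" "j < sum_list d" "j \<notin> block_indices d \<Gamma>"
  then have "j \<in> block_indices d {..<length d}" by simp
  then obtain i where "i < length d" "j \<in> block_range d i"
    by (auto simp: block_indices_def)
  then show "v $ j = 0"
    using * block_indices_iff[OF assms] by (auto simp: block_supp_iff subset_iff)
next
  fix i assume *: "\<forall>j<sum_list d. j \<notin> block_indices d \<Gamma> \<longrightarrow> v $ j = 0" and "i \<in> block_supp d v"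
  then obtain j where "i < length d" "j \<in> block_range d i" "v $ j \<noteq> 0"
    by (auto simp: block_supp_iff)
  with * show "i \<in> \<Gamma>"
    using block_indices_iff[OF assms] block_range_subset by blast
qed

lemma block_supp_restrict:
  "v \<in> carrier_vec (sum_list d) \<Longrightarrow> \<Gamma> \<subseteq> {..<length d} \<Longrightarrow>
    block_supp d (block_restrict d \<Gamma> v) \<subseteq> \<Gamma>"
  by (subst block_supp_subset_iff) auto

lemma
  assumes "u \<in> carrier_vec (sum_list d)" "v \<in> carrier_vec (sum_list d)" "\<Gamma> \<subseteq> {..<length d}"
    and "block_supp d u \<subseteq> \<Gamma>" "block_supp d v \<subseteq> \<Gamma>"
  shows block_supp_add: "block_supp d (u + v) \<subseteq> \<Gamma>"
    and block_supp_diff: "block_supp d (u - v) \<subseteq> \<Gamma>"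
  using assms by (simp_all add: block_supp_subset_iff)

lemma block_supp_smult:
  assumes "v \<in> carrier_vec (sum_list d)" "\<Gamma> \<subseteq> {..<length d}" "block_supp d v \<subseteq> \<Gamma>"
  shows "block_supp d (c \<cdot>\<^sub>v v) \<subseteq> \<Gamma>"
  using assms by (simp add: block_supp_subset_iff)

lemma block_restrict_self_prod:
  assumes "v \<in> carrier_vec (sum_list d)" "\<Gamma> \<subseteq> {..<length d}"
  shows "block_restrict d \<Gamma> v \<bullet> block_restrict d \<Gamma> v = (\<Sum>i\<in>\<Gamma>. (vec_l2 (vec_block d v i))\<^sup>2)"
proof -
  have "block_restrict d \<Gamma> v \<bullet> block_restrict d \<Gamma> v
      = (\<Sum>j\<in>{..<sum_list d}. if j \<in> block_indices d \<Gamma> then (v $ j)\<^sup>2 else 0)"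
    using assms by (auto simp: scalar_prod_def power2_eq_square lessThan_atLeast0 intro!: sum.cong)
  also have "\<dots> = (\<Sum>j\<in>block_indices d \<Gamma>. (v $ j)\<^sup>2)"
    using block_indices_subset[OF assms(2)] by (simp add: sum.If_cases Int_absorb1)
  finally show ?thesis
    using assms(2) by (simp add: sum_block_indices vec_l2_vec_block_power2)
qed

text \<open>Restriction to blocks is an orthogonal projection, hence self-adjoint and
  idempotent.\<close>

lemma scalar_prod_block_restrict:
  assumes "u \<in> carrier_vec n" "v \<in> carrier_vec n"
  shows "block_restrict d \<Gamma> u \<bullet> v = block_restrict d \<Gamma> u \<bullet> block_restrict d \<Gamma> v"
  using assms by (auto simp: scalar_prod_def intro!: sum.cong)

section \<open>Column submatrices and embedded coefficient vectors\<close>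

lemma bij_betw_pick:
  assumes "finite J"
  shows "bij_betw (pick J) {..<card J} J"
proof (rule bij_betw_imageI)
  show "inj_on (pick J) {..<card J}"
    by (rule inj_on_inverseI[of _ "\<lambda>j. card {a\<in>J. a < j}"]) (simp add: card_pick_le)
  have "j \<in> pick J ` {..<card J}" if "j \<in> J" for j
  proof (rule image_eqI)
    show "j = pick J (card {a\<in>J. a < j})"
      using that by (rule pick_card_in_set[symmetric])
    show "card {a\<in>J. a < j} \<in> {..<card J}"
      using assms that by (auto intro!: psubset_card_mono)
  qed
  then show "pick J ` {..<card J} = J"
    using pick_in_set_le by (intro equalityI subsetI) (auto simp del: pick.simps)
qed

text \<open>The index \<open>card {a\<in>J. a < j}\<close> is the position of \<open>j\<close> in \<open>J\<close>, the inverse of \<^term>\<open>pick J\<close>.\<close>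

definition embed_vec :: "nat \<Rightarrow> nat set \<Rightarrow> real vec \<Rightarrow> real vec" where
  "embed_vec n J u = vec n (\<lambda>j. if j \<in> J then u $ card {a\<in>J. a < j} else 0)"

lemma submatrix_UNIV_carrier:
  assumes "A \<in> carrier_mat m n" "J \<subseteq> {..<n}"
  shows "submatrix A UNIV J \<in> carrier_mat m (card J)"
proof -
  have "{j. j < n \<and> j \<in> J} = J" using assms(2) by blast
  then show ?thesis using assms(1) by (simp add: submatrix_def)
qed

lemma submatrix_UNIV_index:
  assumes "A \<in> carrier_mat m n" "J \<subseteq> {..<n}" "i < m" "j < card J"
  shows "submatrix A UNIV J $$ (i, j) = A $$ (i, pick J j)"
proof -
  have "{j. j < n \<and> j \<in> J} = J" using assms(2) by blast
  then show ?thesis using assms by (simp add: submatrix_def pick_UNIV)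
qed

text \<open>The columns outside \<open>J\<close> meet zero entries of the embedded vector, and
  \<open>pick J\<close> reindexes the others. Coefficients for selected columns can thus be treated
  as signals in the full space, where the block-RIP applies.\<close>

lemma submatrix_UNIV_mult_vec:
  fixes A :: "real mat"
  assumes A: "A \<in> carrier_mat m n" and J: "J \<subseteq> {..<n}" and u: "u \<in> carrier_vec (card J)"
  shows "submatrix A UNIV J *\<^sub>v u = A *\<^sub>v embed_vec n J u"
proof (rule eq_vecI)
  have fin: "finite J" using J finite_subset by blast
  have B: "submatrix A UNIV J \<in> carrier_mat m (card J)"
    using A J by (rule submatrix_UNIV_carrier)
  fix i assume "i < dim_vec (A *\<^sub>v embed_vec n J u)"
  then have i: "i < m" using A by simp
  have "(A *\<^sub>v embed_vec n J u) $ i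
      = (\<Sum>j\<in>{..<n}. if j \<in> J then A $$ (i, j) * u $ card {a\<in>J. a < j} else 0)"
    using A i by (auto simp: scalar_prod_def embed_vec_def lessThan_atLeast0 intro!: sum.cong)
  also have "\<dots> = (\<Sum>j\<in>J. A $$ (i, j) * u $ card {a\<in>J. a < j})"
    using J by (simp add: sum.If_cases Int_absorb1)
  also have "\<dots> = (\<Sum>j<card J. A $$ (i, pick J j) * u $ card {a\<in>J. a < pick J j})"
    by (rule sum.reindex_bij_betw[OF bij_betw_pick[OF fin], symmetric])
  also have "\<dots> = (\<Sum>j<card J. submatrix A UNIV J $$ (i, j) * u $ j)"
    using A J i by (intro sum.cong) (simp_all add: card_pick_le submatrix_UNIV_index)
  also have "\<dots> = (submatrix A UNIV J *\<^sub>v u) $ i"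
    using B i u by (simp add: scalar_prod_def lessThan_atLeast0)
  finally show "(submatrix A UNIV J *\<^sub>v u) $ i = (A *\<^sub>v embed_vec n J u) $ i" by simp
qed (use A submatrix_UNIV_carrier[OF A J] in auto)

lemma transpose_submatrix_UNIV_mult_vec:
  fixes A :: "real mat"
  assumes A: "A \<in> carrier_mat m n" and J: "J \<subseteq> {..<n}" and r: "r \<in> carrier_vec m"
  shows "transpose_mat (submatrix A UNIV J) *\<^sub>v r
    = vec (card J) (\<lambda>j. (transpose_mat A *\<^sub>v r) $ pick J j)"
proof (rule eq_vecI)
  have B: "submatrix A UNIV J \<in> carrier_mat m (card J)"
    using A J by (rule submatrix_UNIV_carrier)
  fix j assume "j < dim_vec (vec (card J) (\<lambda>j. (transpose_mat A *\<^sub>v r) $ pick J j))"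
  then have j: "j < card J" by simp
  then have "pick J j < n" using J pick_in_set_le by blast
  then show "(transpose_mat (submatrix A UNIV J) *\<^sub>v r) $ j
      = vec (card J) (\<lambda>j. (transpose_mat A *\<^sub>v r) $ pick J j) $ j"
    using A B r j J by (auto simp: scalar_prod_def submatrix_UNIV_index intro!: sum.cong)
qed (use A submatrix_UNIV_carrier[OF A J] in auto)

lemma pick_atLeastLessThan:
  assumes "j < b"
  shows "pick {a..<a + b} j = a + j"
proof -
  have "{i \<in> {a..<a + b}. i < a + j} = {a..<a + j}" using assms by auto
  then show ?thesis using pick_card_in_set[of "a + j" "{a..<a + b}"] assms by simp
qed

text \<open>On an interval \<open>pick\<close> is a translation. The quantities compared in the
  identification step become block norms of the single vector
  \<open>transpose_mat A *\<^sub>v r\<close>.\<close>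

lemma transpose_mat_block_mult_vec:
  fixes A :: "real mat"
  assumes "A \<in> carrier_mat m (sum_list d)" "i < length d" "r \<in> carrier_vec m"
  shows "transpose_mat (mat_block d A i) *\<^sub>v r = vec_block d (transpose_mat A *\<^sub>v r) i"
  using transpose_submatrix_UNIV_mult_vec[OF assms(1) block_range_subset[OF assms(2)] assms(3)]
  by (auto simp: mat_blocks_def vec_block_def block_range_def pick_atLeastLessThan)

section \<open>Block-RIP and the selection step\<close>

text \<open>A \<open>LEAST\<close> over the reals is informative only if the minimum exists. For
  each fixed signal the two RIP inequalities are closed conditions on \<open>\<delta>\<close>, in
  fact lower bounds for it, so they pass to the infimum of the admissible constants. The strict
  bound by 1 survives because the infimum is below one admissible constant.\<close>

lemma block_RIP_bound_block_RIC:
  assumes "block_RIP d A K"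
  shows "block_RIP_bound d A K (block_RIC d A K)"
proof -
  define D where "D = {\<delta>. block_RIP_bound d A K \<delta>}"
  obtain \<delta>\<^sub>0 where \<delta>\<^sub>0: "block_RIP_bound d A K \<delta>\<^sub>0" using assms by (auto simp: block_RIP_def)
  have bdd: "bdd_below D" by (rule bdd_belowI[of _ 0]) (simp add: D_def block_RIP_bound_def)
  have D0: "\<delta>\<^sub>0 \<in> D" using \<delta>\<^sub>0 by (simp add: D_def)
  have Inf_le: "Inf D \<le> \<delta>" if "block_RIP_bound d A K \<delta>" for \<delta>
    using that bdd by (auto simp: D_def intro: cInf_lower)
  have Inf_ge: "b \<le> Inf D" if "\<And>\<delta>. block_RIP_bound d A K \<delta> \<Longrightarrow> b \<le> \<delta>" for b
    using D0 that by (auto simp: D_def intro: cInf_greatest)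
  have "block_RIP_bound d A K (Inf D)"
    unfolding block_RIP_bound_def
  proof (intro conjI ballI impI)
    show "0 \<le> Inf D" by (rule Inf_ge) (simp add: block_RIP_bound_def)
    show "Inf D < 1" using Inf_le[OF \<delta>\<^sub>0] \<delta>\<^sub>0 by (simp add: block_RIP_bound_def)
    fix x assume x: "x \<in> carrier_vec (sum_list d)" "block_sparse d K x"
    let ?X = "(vec_l2 x)\<^sup>2" and ?Y = "(vec_l2 (A *\<^sub>v x))\<^sup>2"
    have "(1 - Inf D) * ?X \<le> ?Y \<and> ?Y \<le> (1 + Inf D) * ?X"
    proof (cases "vec_l2 x = 0")
      case True
      then show ?thesis using \<delta>\<^sub>0 x by (auto simp: block_RIP_bound_def)
    next
      case False
      then have X: "?X > 0" by simp
      have "1 - ?Y / ?X \<le> Inf D"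
        using x X by (intro Inf_ge) (auto simp: block_RIP_bound_def field_simps)
      moreover have "?Y / ?X - 1 \<le> Inf D"
        using x X by (intro Inf_ge) (auto simp: block_RIP_bound_def field_simps)
      ultimately show ?thesis using X by (simp add: field_simps)
    qed
    then show "(1 - Inf D) * ?X \<le> ?Y" "?Y \<le> (1 + Inf D) * ?X" by auto
  qed
  then show ?thesis
    unfolding block_RIC_def by (rule LeastI2_order) (auto intro: Inf_le)
qed

lemma block_sparse_if_subset:
  "block_supp d v \<subseteq> \<Gamma> \<Longrightarrow> \<Gamma> \<subseteq> {..<length d} \<Longrightarrow> card \<Gamma> \<le> M \<Longrightarrow> block_sparse d M v"
  unfolding block_sparse_def by (meson card_mono finite_lessThan finite_subset le_trans)

text \<open>The factor \<open>1 - \<delta>\<close> in the lower RIP inequality is positive, so a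
  signal in the kernel has norm zero.\<close>

lemma block_RIP_bound_imp_inj:
  fixes A :: "real mat"
  assumes A: "A \<in> carrier_mat m (sum_list d)" and RIP: "block_RIP_bound d A M \<delta>"
    and \<Gamma>: "\<Gamma> \<subseteq> {..<length d}" "card \<Gamma> \<le> M"
    and u: "u \<in> carrier_vec (sum_list d)" "block_supp d u \<subseteq> \<Gamma>" and 0: "A *\<^sub>v u = 0\<^sub>v m"
  shows "u = 0\<^sub>v (sum_list d)"
proof -
  have "block_sparse d M u" using u \<Gamma> by (intro block_sparse_if_subset)
  then have "(1 - \<delta>) * (u \<bullet> u) \<le> 0" and "\<delta> < 1"
    using RIP u 0 by (auto simp: block_RIP_bound_def vec_l2_power2)
  then have "u \<bullet> u = 0"
    using scalar_prod_self_nonneg[of u] by (auto simp: mult_le_0_iff)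
  then show ?thesis using u scalar_prod_self_eq_0_iff by blast
qed

text \<open>Polarization: four times an inner product is the difference of the squared norms of sum
  and difference. Both of these signals are supported on the common set \<open>\<Gamma>\<close>, so
  its size, and not the sum of two sparsities, has to respect the order of the RIP.\<close>

lemma block_RIP_bound_scalar_prod:
  fixes A :: "real mat"
  assumes A: "A \<in> carrier_mat m (sum_list d)" and RIP: "block_RIP_bound d A M \<delta>"
    and \<Gamma>: "\<Gamma> \<subseteq> {..<length d}" "card \<Gamma> \<le> M"
    and u: "u \<in> carrier_vec (sum_list d)" "block_supp d u \<subseteq> \<Gamma>"
    and v: "v \<in> carrier_vec (sum_list d)" "block_supp d v \<subseteq> \<Gamma>"
  shows "(A *\<^sub>v u) \<bullet> (A *\<^sub>v v) \<le> u \<bullet> v + \<delta> * (vec_l2 u * vec_l2 v)"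
proof (cases "vec_l2 u = 0 \<or> vec_l2 v = 0")
  case True
  then have "u = 0\<^sub>v (sum_list d) \<or> v = 0\<^sub>v (sum_list d)"
    using u v by (metis scalar_prod_self_eq_0_iff vec_l2_power2 power2_eq_square mult_zero_left)
  moreover have "A *\<^sub>v 0\<^sub>v (sum_list d) = 0\<^sub>v m" using A by (intro eq_vecI) auto
  moreover have "A *\<^sub>v u \<in> carrier_vec m" "A *\<^sub>v v \<in> carrier_vec m" using A u v by auto
  moreover have "vec_l2 u * vec_l2 v = 0" using True by auto
  ultimately show ?thesis using u v by auto
next
  case False
  define a b where "a = vec_l2 u" and "b = vec_l2 v"
  have ab: "a > 0" "b > 0" using False by (simp_all add: a_def b_def order_less_le)
  have aa: "u \<bullet> u = a\<^sup>2" "v \<bullet> v = b\<^sup>2" by (simp_all add: a_def b_def vec_l2_power2)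
  \<comment> \<open>Scaling to equal norms is what yields the product of the norms: for
    \<open>u\<close> and \<open>v\<close> themselves, polarization gives only the mean of the two
    squared norms as the factor of \<open>\<delta>\<close>.\<close>
  define s t where "s = b \<cdot>\<^sub>v u" and "t = a \<cdot>\<^sub>v v"
  have s: "s \<in> carrier_vec (sum_list d)" "block_supp d s \<subseteq> \<Gamma>"
    and t: "t \<in> carrier_vec (sum_list d)" "block_supp d t \<subseteq> \<Gamma>"
    using u v block_supp_smult[OF _ \<Gamma>(1)] by (simp_all add: s_def t_def)
  have As: "A *\<^sub>v s \<in> carrier_vec m" and At: "A *\<^sub>v t \<in> carrier_vec m"
    and Au: "A *\<^sub>v u \<in> carrier_vec m" and Av: "A *\<^sub>v v \<in> carrier_vec m"
    using A s t u v by auto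
  have "block_sparse d M (s + t)" "block_sparse d M (s - t)"
    using block_supp_add[OF s(1) t(1) \<Gamma>(1) s(2) t(2)] block_supp_diff[OF s(1) t(1) \<Gamma>(1) s(2) t(2)] \<Gamma>
    by (simp_all add: block_sparse_if_subset)
  then have "(A *\<^sub>v (s + t)) \<bullet> (A *\<^sub>v (s + t)) \<le> (1 + \<delta>) * ((s + t) \<bullet> (s + t))"
    "(1 - \<delta>) * ((s - t) \<bullet> (s - t)) \<le> (A *\<^sub>v (s - t)) \<bullet> (A *\<^sub>v (s - t))"
    using RIP s t by (auto simp: block_RIP_bound_def vec_l2_power2)
  then have "4 * ((A *\<^sub>v s) \<bullet> (A *\<^sub>v t)) \<le> 4 * (s \<bullet> t) + 2 * \<delta> * (s \<bullet> s + t \<bullet> t)"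
    by (simp add: mult_add_distrib_mat_vec[OF A s(1) t(1)] mult_minus_distrib_mat_vec[OF A s(1) t(1)]
        scalar_prod_add_self[OF As At] scalar_prod_diff_self[OF As At]
        scalar_prod_add_self[OF s(1) t(1)] scalar_prod_diff_self[OF s(1) t(1)] algebra_simps)
  moreover have "s \<bullet> t = (a * b) * (u \<bullet> v)" "s \<bullet> s = (a * b)\<^sup>2" "t \<bullet> t = (a * b)\<^sup>2"
    using u v aa by (simp_all add: s_def t_def power2_eq_square)
  moreover have "(A *\<^sub>v s) \<bullet> (A *\<^sub>v t) = (a * b) * ((A *\<^sub>v u) \<bullet> (A *\<^sub>v v))"
    using Au Av by (simp add: s_def t_def mult_mat_vec[OF A u(1)] mult_mat_vec[OF A v(1)])
  ultimately have "(a * b) * ((A *\<^sub>v u) \<bullet> (A *\<^sub>v v)) \<le> (a * b) * (u \<bullet> v + \<delta> * (a * b))"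
    by (simp add: algebra_simps power2_eq_square)
  then show ?thesis
    using ab by (simp add: a_def[symmetric] b_def[symmetric])
qed

text \<open>
  The test vector \<open>w\<close> below is, up to scaling, the compression of \<open>(A\<^sup>T A - 1) z\<close> to the plane spanned
  by \<open>z\<close> and \<open>h\<close> in the extremal case.
\<close>

lemma largest_blocks_meets_support:
  fixes A :: "real mat"
  assumes A: "A \<in> carrier_mat m (sum_list d)" and RIP: "block_RIP_bound d A M \<delta>"
    and \<delta>: "\<delta> < 1 / sqrt (real K / real N + 1)" and K: "K > 0" and N: "N > 0"
    and S: "S \<subseteq> {..<length d}" and \<Lambda>: "\<Lambda> \<subseteq> {..<length d}" and SK: "card (S - \<Lambda>) \<le> K"
    and z: "z \<in> carrier_vec (sum_list d)" "block_supp d z \<subseteq> S \<union> \<Lambda>"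
    and nz: "A *\<^sub>v z \<noteq> 0\<^sub>v m"
    and normal: "\<And>j. j \<in> block_indices d \<Lambda> \<Longrightarrow> (transpose_mat A *\<^sub>v (A *\<^sub>v z)) $ j = 0"
    and T: "largest_blocks d A N (A *\<^sub>v z) T" and M: "card (S \<union> \<Lambda> \<union> T) \<le> M"
  shows "T \<inter> (S - \<Lambda>) \<noteq> {}"
proof
  assume disj: "T \<inter> (S - \<Lambda>) = {}"
  let ?n = "sum_list d"
  define r where "r = A *\<^sub>v z"
  define g where "g = transpose_mat A *\<^sub>v r"
  define h where "h = block_restrict d T g"
  define q where "q = block_restrict d (S - \<Lambda>) g"
  define \<beta> where "\<beta> i = vec_l2 (vec_block d g i)" for i
  have Tl: "T \<subseteq> {..<length d}" and Tc: "card T = N" using T by (auto simp: largest_blocks_def)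
  have r: "r \<in> carrier_vec m" and g: "g \<in> carrier_vec ?n" using A z by (auto simp: r_def g_def)
  have h: "h \<in> carrier_vec ?n" and q: "q \<in> carrier_vec ?n" using g by (auto simp: h_def q_def)
  have hT: "block_supp d h \<subseteq> T" using block_supp_restrict[OF g Tl] by (simp add: h_def)
  have SL: "S - \<Lambda> \<subseteq> {..<length d}" and SuL: "S \<union> \<Lambda> \<subseteq> {..<length d}" using S \<Lambda> by auto
  have g0: "g $ j = 0" if "j \<in> block_indices d \<Lambda>" for j using normal that by (simp add: g_def r_def)
  have z0: "z $ j = 0" if "j < ?n" "j \<notin> block_indices d (S \<union> \<Lambda>)" for j
    using z that block_supp_subset_iff[OF SuL] by blast

  \<comment> \<open>Outside \<open>S \<union> \<Lambda>\<close> the factor \<open>z\<close>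
    vanishes, and on \<open>\<Lambda>\<close> the factor \<open>g\<close> does; only the support
    blocks still missing contribute.\<close>
  have rr: "r \<bullet> r = z \<bullet> q"
  proof -
    have "r \<bullet> r = z \<bullet> g" using mult_mat_vec_scalar_prod[OF A z(1) r] by (simp add: r_def g_def)
    also have "\<dots> = z \<bullet> q"
    proof -
      have "z $ j * g $ j = z $ j * q $ j" if "j < ?n" for j
      proof (cases "j \<in> block_indices d (S - \<Lambda>) \<or> j \<in> block_indices d \<Lambda>")
        case True
        then show ?thesis using g g0 that by (auto simp: q_def)
      next
        case False
        then have "j \<notin> block_indices d (S \<union> \<Lambda>)" by (auto simp: block_indices_def)
        then show ?thesis using z0 that by simp
      qed
      then show ?thesis using g q by (fastforce simp: scalar_prod_def intro!: sum.cong)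
    qed
    finally show ?thesis .
  qed
  \<comment> \<open>By \<open>disj\<close>, a block of \<open>T\<close> that meets the support of
    \<open>z\<close> lies in \<open>\<Lambda>\<close>, where \<open>g\<close> and hence
    \<open>h\<close> is zero.\<close>
  have zh: "z \<bullet> h = 0"
  proof -
    have "z $ j * h $ j = 0" if "j < ?n" for j
    proof (cases "j \<in> block_indices d T \<and> j \<in> block_indices d (S \<union> \<Lambda>)")
      case True
      then obtain i where i: "i \<in> T" "j \<in> block_range d i" by (auto simp: block_indices_def)
      then have "i \<in> S \<union> \<Lambda>" using True Tl block_indices_iff[OF SuL] by blast
      then have "j \<in> block_indices d \<Lambda>" using i disj by (auto simp: block_indices_def)
      then show ?thesis using g0 g that by (simp add: h_def)
    next
      case False
      then show ?thesis using z0 g that by (auto simp: h_def)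
    qed
    then show ?thesis using h by (fastforce simp: scalar_prod_def intro!: sum.neutral)
  qed
  have rh: "r \<bullet> (A *\<^sub>v h) = h \<bullet> h"
  proof -
    have "(A *\<^sub>v h) \<bullet> r = h \<bullet> g"
      using mult_mat_vec_scalar_prod[OF A h r] by (simp add: g_def)
    also have "\<dots> = h \<bullet> h" unfolding h_def by (rule scalar_prod_block_restrict[OF g g])
    finally show ?thesis using comm_scalar_prod[OF r, of "A *\<^sub>v h"] A h by simp
  qed

  \<comment> \<open>Each missing block has correlation at most that of each of the \<open>N\<close>
    selected blocks, so \<open>N\<close> times its square is bounded by the total over
    \<open>T\<close>. Summing over at most \<open>K\<close> missing blocks gives the factor
    \<open>K\<close>.\<close>
  have Nq: "N * (q \<bullet> q) \<le> K * (h \<bullet> h)"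
  proof -
    have hh: "h \<bullet> h = (\<Sum>i\<in>T. (\<beta> i)\<^sup>2)" and qq: "q \<bullet> q = (\<Sum>i\<in>S - \<Lambda>. (\<beta> i)\<^sup>2)"
      using block_restrict_self_prod[OF g Tl] block_restrict_self_prod[OF g SL]
      by (simp_all add: h_def q_def \<beta>_def)
    have le: "N * (\<beta> j)\<^sup>2 \<le> h \<bullet> h" if j: "j \<in> S - \<Lambda>" for j
    proof -
      have "(\<beta> j)\<^sup>2 \<le> (\<beta> i)\<^sup>2" if i: "i \<in> T" for i
      proof -
        have jl: "j < length d" and il: "i < length d" and "j \<notin> T" using j i S Tl disj by auto
        then have "vec_l2 (transpose_mat (mat_block d A j) *\<^sub>v r)
            \<le> vec_l2 (transpose_mat (mat_block d A i) *\<^sub>v r)"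
          using T i by (simp add: largest_blocks_def r_def)
        then have "\<beta> j \<le> \<beta> i"
          by (simp add: transpose_mat_block_mult_vec[OF A jl r]
              transpose_mat_block_mult_vec[OF A il r] \<beta>_def g_def)
        then show ?thesis by (rule power_mono) (simp add: \<beta>_def)
      qed
      then have "(\<Sum>i\<in>T. (\<beta> j)\<^sup>2) \<le> (\<Sum>i\<in>T. (\<beta> i)\<^sup>2)" by (rule sum_mono)
      then show ?thesis by (simp add: hh Tc)
    qed
    have "N * (q \<bullet> q) = (\<Sum>j\<in>S - \<Lambda>. N * (\<beta> j)\<^sup>2)" by (simp add: qq sum_distrib_left)
    also have "\<dots> \<le> card (S - \<Lambda>) * (h \<bullet> h)" using sum_mono[of "S - \<Lambda>", OF le] by simp
    also have "\<dots> \<le> K * (h \<bullet> h)" using SK by (intro mult_right_mono) (simp_all add: scalar_prod_self_nonneg)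
    finally show ?thesis .
  qed

  define a \<sigma> c where "a = vec_l2 z" and "\<sigma> = vec_l2 h" and "c = sqrt (real N / real K)"
  have zz: "z \<bullet> z = a\<^sup>2" and hh: "h \<bullet> h = \<sigma>\<^sup>2" by (simp_all add: a_def \<sigma>_def vec_l2_power2)
  have c: "c > 0" "c\<^sup>2 = N / K" using K N by (simp_all add: c_def)
  have pos: "r \<bullet> r > 0"
    using nz scalar_prod_self_eq_0_iff[OF r] scalar_prod_self_nonneg[of r] by (simp add: r_def order_less_le)
  \<comment> \<open>Cauchy-Schwarz for \<open>r \<bullet> r = z \<bullet> q\<close>, followed by
    \<open>Nq\<close> to pass from \<open>q\<close> to \<open>h\<close>.\<close>
  have "(c * (r \<bullet> r))\<^sup>2 \<le> (a * \<sigma>)\<^sup>2"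
  proof -
    have "N * (r \<bullet> r)\<^sup>2 \<le> (z \<bullet> z) * (N * (q \<bullet> q))"
      using mult_left_mono[OF scalar_prod_power2_le[OF z(1) q], of "real N"] by (simp add: rr algebra_simps)
    also have "\<dots> \<le> (z \<bullet> z) * (K * (h \<bullet> h))"
      using Nq by (intro mult_left_mono) (simp_all add: scalar_prod_self_nonneg)
    finally show ?thesis using K by (simp add: power_mult_distrib c zz hh field_simps)
  qed
  moreover have a\<sigma>: "a \<ge> 0" "\<sigma> \<ge> 0" by (simp_all add: a_def \<sigma>_def)
  ultimately have cr: "c * (r \<bullet> r) \<le> a * \<sigma>" by (rule_tac power2_le_imp_le) auto
  \<comment> \<open>The nonzero residual makes the left side of \<open>cr\<close> positive; both
    norms are cancelled at the end.\<close>
  then have apos: "a > 0" "\<sigma> > 0"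
    using a\<sigma> mult_pos_pos[OF c(1) pos] by (auto simp: order_less_le)

  define w where "w = a \<cdot>\<^sub>v h - (c * \<sigma>) \<cdot>\<^sub>v z"
  have w: "w \<in> carrier_vec ?n" using h z by (simp add: w_def)
  have \<Gamma>: "S \<union> \<Lambda> \<union> T \<subseteq> {..<length d}" using SuL Tl by auto
  have hT': "block_supp d h \<subseteq> S \<union> \<Lambda> \<union> T" and zT: "block_supp d z \<subseteq> S \<union> \<Lambda> \<union> T"
    using hT z by auto
  have "block_supp d w \<subseteq> S \<union> \<Lambda> \<union> T"
    unfolding w_def using h z(1)
    by (intro block_supp_diff block_supp_smult \<Gamma> hT' zT) simp_all
  then have le: "r \<bullet> (A *\<^sub>v w) \<le> z \<bullet> w + \<delta> * (a * vec_l2 w)"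
    using block_RIP_bound_scalar_prod[OF A RIP \<Gamma> M z(1) zT w] by (simp add: r_def a_def)
  have "r \<bullet> (A *\<^sub>v w) = a * (h \<bullet> h) - c * \<sigma> * (r \<bullet> r)"
  proof -
    have Ah: "A *\<^sub>v h \<in> carrier_vec m" using A h by auto
    have "A *\<^sub>v w = a \<cdot>\<^sub>v (A *\<^sub>v h) - (c * \<sigma>) \<cdot>\<^sub>v r"
      unfolding w_def r_def using h z(1) mult_mat_vec[OF A h] mult_mat_vec[OF A z(1)]
      by (subst mult_minus_distrib_mat_vec[OF A]) auto
    then show ?thesis
      using r Ah by (simp add: scalar_prod_minus_distrib[of _ m] rh)
  qed
  also have "\<dots> = \<sigma> * (a * \<sigma> - c * (r \<bullet> r))" by (simp add: hh power2_eq_square algebra_simps)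
  also have "\<dots> \<ge> 0" using cr a\<sigma> by simp
  finally have ge: "0 \<le> r \<bullet> (A *\<^sub>v w)" .
  have zw: "z \<bullet> w = - (c * \<sigma> * a\<^sup>2)"
    using h z(1) by (simp add: w_def scalar_prod_minus_distrib[of _ ?n] zh zz)
  have "(vec_l2 w)\<^sup>2 = (sqrt (1 + c\<^sup>2) * (a * \<sigma>))\<^sup>2"
  proof -
    have "h \<bullet> z = 0" using zh comm_scalar_prod[OF h z(1)] by simp
    then have "(vec_l2 w)\<^sup>2 = a\<^sup>2 * \<sigma>\<^sup>2 + (c * \<sigma>)\<^sup>2 * a\<^sup>2"
      unfolding vec_l2_power2 w_def using h z(1)
      by (subst scalar_prod_diff_self[of _ ?n]) (auto simp: zz hh power2_eq_square)
    then show ?thesis by (simp add: power_mult_distrib algebra_simps)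
  qed
  then have vw: "vec_l2 w = sqrt (1 + c\<^sup>2) * (a * \<sigma>)"
    by (rule power2_eq_imp_eq) (use a\<sigma> in auto)
  \<comment> \<open>The lower bound 0 and the RIP upper bound for
    \<open>r \<bullet> (A *\<^sub>v w)\<close> are put together, with the norm of \<open>w\<close>
    computed from the orthogonality of \<open>z\<close> and \<open>h\<close>.\<close>
  have "c * (a\<^sup>2 * \<sigma>) \<le> (\<delta> * sqrt (1 + c\<^sup>2)) * (a\<^sup>2 * \<sigma>)"
    using le ge by (simp add: zw vw power2_eq_square algebra_simps)
  then have "c \<le> \<delta> * sqrt (1 + c\<^sup>2)" using apos by simp
  also have "\<dots> < 1 / sqrt (real K / real N + 1) * sqrt (1 + c\<^sup>2)"
    using \<delta> by (intro mult_strict_right_mono) (auto intro: add_pos_nonneg)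
  \<comment> \<open>Since \<open>c\<^sup>2\<close> is \<open>N / K\<close>, the number
    \<open>1 + c\<^sup>2\<close> equals \<open>c\<^sup>2 * (K / N + 1)\<close>: the assumed
    threshold is exactly \<open>c / sqrt (1 + c\<^sup>2)\<close>.\<close>
  also have "\<dots> = c"
  proof -
    have "1 + real N / real K = (real N / real K) * (real K / real N + 1)"
      using K N by (simp add: field_simps)
    then have "sqrt (1 + c\<^sup>2) = c * sqrt (real K / real N + 1)"
      by (metis c(2) c_def real_sqrt_mult)
    moreover have "sqrt (real K / real N + 1) > 0" by (simp add: add_nonneg_pos)
    ultimately show ?thesis by simp
  qed
  finally show False by simp
qed

section \<open>Runs of BOMMP\<close>

lemma block_supp_embed_vec:
  "\<Gamma> \<subseteq> {..<length d} \<Longrightarrow>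
    block_supp d (embed_vec (sum_list d) (block_indices d \<Gamma>) u) \<subseteq> \<Gamma>"
  by (simp add: block_supp_subset_iff embed_vec_def)

lemma embed_vec_eq_0_imp:
  assumes J: "J \<subseteq> {..<n}" and u: "u \<in> carrier_vec (card J)" and 0: "embed_vec n J u = 0\<^sub>v n"
  shows "u = 0\<^sub>v (card J)"
proof (rule eq_vecI)
  fix k assume "k < dim_vec (0\<^sub>v (card J))"
  then have k: "k < card J" by simp
  then have p: "pick J k \<in> J" "pick J k < n" using J pick_in_set_le by blast+
  then have "u $ k = embed_vec n J u $ pick J k"
    using k by (simp add: embed_vec_def card_pick_le)
  also have "\<dots> = 0" using 0 p by simp
  finally show "u $ k = 0\<^sub>v (card J) $ k" using k by simp
qed (use u in simp)

text \<open>Greedy choice: a maximizer of \<open>f\<close> among the remaining elements is adjoined,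
  and the earlier members dominate the rest already.\<close>

lemma exists_largest_subset:
  fixes f :: "'a \<Rightarrow> 'b :: linorder"
  assumes "finite X" "N \<le> card X"
  shows "\<exists>T \<subseteq> X. card T = N \<and> (\<forall>i \<in> T. \<forall>j \<in> X - T. f j \<le> f i)"
  using assms(2)
proof (induction N)
  case 0
  show ?case by (rule exI[of _ "{}"]) simp
next
  case (Suc N)
  then obtain T where T: "T \<subseteq> X" "card T = N" "\<And>i j. i \<in> T \<Longrightarrow> j \<in> X - T \<Longrightarrow> f j \<le> f i"
    by (meson Suc_leD)
  have fin: "finite T" using T(1) assms(1) finite_subset by blast
  have "X - T \<noteq> {}" using T Suc.prems fin card_mono[of T X] by fastforce
  then have "Max (f ` (X - T)) \<in> f ` (X - T)" using assms(1) by (intro Max_in) auto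
  then obtain a where a: "a \<in> X - T" "f a = Max (f ` (X - T))" by (metis imageE)
  have "f j \<le> f a" if "j \<in> X - T" for j
    unfolding a(2) using assms(1) that by (intro Max_ge) auto
  then have "f j \<le> f i" if "i \<in> insert a T" "j \<in> X - insert a T" for i j
    using T(3) that by blast
  moreover have "insert a T \<subseteq> X" "card (insert a T) = Suc N" using T a fin by auto
  ultimately show ?case by blast
qed

lemma exists_largest_blocks:
  assumes "N \<le> length d"
  obtains T where "largest_blocks d A N r T"
  using exists_largest_subset[of "{..<length d}" N "\<lambda>i. vec_l2 (transpose_mat (mat_block d A i) *\<^sub>v r)"] assms
  unfolding largest_blocks_def by auto

text \<open>Progress is measured by the support blocks already in \<open>\<Lambda>\<close>, at least
  one per iteration. The representation of \<open>r\<close> and the vanishing correlations on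
  \<open>\<Lambda>\<close> are what the selection argument needs in the next iteration; the
  cardinality bounds keep that argument within the order of the RIP.\<close>

lemma bommp_state_invariant:
  fixes A :: "real mat"
  assumes "bommp_state d A (A *\<^sub>v x) K N \<epsilon> k \<Lambda> r"
    and A: "A \<in> carrier_mat m (sum_list d)" and x: "x \<in> carrier_vec (sum_list d)"
    and RIP: "block_RIP_bound d A (N * K + 1) \<delta>" and sparse: "block_sparse d K x"
    and \<delta>: "\<delta> < 1 / sqrt (real K / real N + 1)" and N: "N > 0" and K: "K > 0" and \<epsilon>: "\<epsilon> \<ge> 0"
  shows "k \<le> K \<and> \<Lambda> \<subseteq> {..<length d} \<and> card \<Lambda> \<le> k * N \<and> k \<le> card (block_supp d x \<inter> \<Lambda>) \<and>
    (\<exists>u \<in> carrier_vec (sum_list d). block_supp d u \<subseteq> \<Lambda> \<and> r = A *\<^sub>v (x - u)) \<and>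
    (\<forall>j \<in> block_indices d \<Lambda>. (transpose_mat A *\<^sub>v r) $ j = 0)"
  using assms(1)
proof (induction rule: bommp_state.induct)
  case init
  have "x - 0\<^sub>v (sum_list d) = x" using x by auto
  moreover have "block_supp d (0\<^sub>v (sum_list d)) \<subseteq> {}"
    by (subst block_supp_subset_iff) auto
  ultimately show ?case
    by (auto simp: block_indices_def intro!: bexI[of _ "0\<^sub>v (sum_list d)"])
next
  case (step k \<Lambda> r T \<Lambda>' z r')
  let ?n = "sum_list d" and ?S = "block_supp d x" and ?J = "block_indices d \<Lambda>'"
  have \<Lambda>: "\<Lambda> \<subseteq> {..<length d}" "card \<Lambda> \<le> k * N" "k \<le> card (?S \<inter> \<Lambda>)"
    and normal: "\<forall>j \<in> block_indices d \<Lambda>. (transpose_mat A *\<^sub>v r) $ j = 0"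
    using step.IH by auto
  obtain u where u: "u \<in> carrier_vec ?n" "block_supp d u \<subseteq> \<Lambda>" "r = A *\<^sub>v (x - u)"
    using step.IH by auto
  have T: "T \<subseteq> {..<length d}" "card T = N"
    using step.hyps(3) by (auto simp: largest_blocks_def)
  have S: "?S \<subseteq> {..<length d}" by (rule block_supp_subset_lessThan)
  have fin: "finite \<Lambda>" "finite T" using \<Lambda> T finite_subset by blast+
  have kK: "k < K" and r0: "vec_l2 r > 0"
    using step.hyps(2) \<epsilon> by (auto simp: bommp_continue_def)
  have SK: "card ?S \<le> K" using sparse by (simp add: block_sparse_def)
  have dS: "card (?S - \<Lambda>) \<le> K - k"
  proof -
    have "card (?S - \<Lambda>) = card ?S - card (?S \<inter> \<Lambda>)" by (rule card_Diff_subset_Int) simp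
    then show ?thesis using SK \<Lambda>(3) by linarith
  qed
  \<comment> \<open>This count dictates the order of the RIP: \<open>k\<close> hits leave at most
    \<open>K - k\<close> support blocks outside \<open>\<Lambda>\<close>, and for
    \<open>k = K - 1\<close> the bound \<open>(K - k) + k * N + N\<close> is exactly
    \<open>N * K + 1\<close>.\<close>
  have card_le: "card (?S \<union> \<Lambda> \<union> T) \<le> N * K + 1"
  proof -
    have "?S \<union> \<Lambda> \<union> T = (?S - \<Lambda>) \<union> \<Lambda> \<union> T" by blast
    then have "card (?S \<union> \<Lambda> \<union> T) \<le> card (?S - \<Lambda>) + card \<Lambda> + card T"
      by (metis add_le_mono1 card_Un_le le_trans)
    also have "\<dots> \<le> (K - k) + k * N + N" using dS \<Lambda>(2) T(2) by linarith
    also have "\<dots> \<le> N * K + 1"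
    proof -
      obtain e where "K = Suc (k + e)" using kK less_iff_Suc_add by blast
      then show ?thesis using N by (cases N) (auto simp: algebra_simps)
    qed
    finally show ?thesis .
  qed
  have xu: "x - u \<in> carrier_vec ?n" using x u by auto
  have "block_supp d (x - u) \<subseteq> ?S \<union> \<Lambda>"
    using x u S \<Lambda>(1) by (intro block_supp_diff) auto
  moreover have "A *\<^sub>v (x - u) \<noteq> 0\<^sub>v m"
    using r0 u(3) by (metis less_irrefl vec_l2_zero)
  ultimately have "T \<inter> (?S - \<Lambda>) \<noteq> {}"
    using largest_blocks_meets_support[OF A RIP \<delta> K N S \<Lambda>(1) _ xu] dS normal step.hyps(3) card_le
    by (simp add: u(3))
  then obtain i where i: "i \<in> T" "i \<in> ?S" "i \<notin> \<Lambda>" by blast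
  have "Suc k \<le> card (insert i (?S \<inter> \<Lambda>))" using i \<Lambda>(3) by simp
  also have "\<dots> \<le> card (?S \<inter> \<Lambda>')" using i step.hyps(4) by (intro card_mono) auto
  finally have hits: "Suc k \<le> card (?S \<inter> \<Lambda>')" .
  have \<Lambda>': "\<Lambda>' \<subseteq> {..<length d}" "card \<Lambda>' \<le> Suc k * N"
    using step.hyps(4) \<Lambda> T card_Un_le[of \<Lambda> T] by auto
  have J: "?J \<subseteq> {..<?n}" using \<Lambda>' by (intro block_indices_subset)
  define B where "B = mat_blocks d A \<Lambda>'"
  have Bdef: "B = submatrix A UNIV ?J" by (simp add: B_def mat_blocks_def block_indices_def)
  have B: "B \<in> carrier_mat m (card ?J)" unfolding Bdef by (rule submatrix_UNIV_carrier[OF A J])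
  have y: "A *\<^sub>v x \<in> carrier_vec m" using A x by auto
  have arg_min: "is_arg_min (\<lambda>u. vec_l2 (A *\<^sub>v x - B *\<^sub>v u)) (\<lambda>u. u \<in> carrier_vec (card ?J)) z"
    using step.hyps(5) B by (simp add: B_def)
  then have z: "z \<in> carrier_vec (card ?J)" by (simp add: is_arg_min_def)
  have r': "r' = A *\<^sub>v x - B *\<^sub>v z" using step.hyps(6) by (simp add: B_def)
  have r'c: "r' \<in> carrier_vec m" using y B z by (auto simp: r')
  define u' where "u' = embed_vec ?n ?J z"
  have u': "u' \<in> carrier_vec ?n" by (simp add: u'_def embed_vec_def)
  have "r' = A *\<^sub>v (x - u')"
    using submatrix_UNIV_mult_vec[OF A J z] mult_minus_distrib_mat_vec[OF A x u']
    by (simp add: r' Bdef u'_def)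
  moreover have "block_supp d u' \<subseteq> \<Lambda>'" unfolding u'_def by (rule block_supp_embed_vec[OF \<Lambda>'(1)])
  \<comment> \<open>The normal equations of the submatrix give zero correlation at each picked
    column, and \<open>pick\<close> exhausts the column set.\<close>
  moreover have "(transpose_mat A *\<^sub>v r') $ j = 0" if j: "j \<in> ?J" for j
  proof -
    have fJ: "finite ?J" using J finite_subset by blast
    then obtain p where p: "p < card ?J" "j = pick ?J p"
      using bij_betw_pick[OF fJ] j unfolding bij_betw_def by blast
    have "vec (card ?J) (\<lambda>j. (transpose_mat A *\<^sub>v r') $ pick ?J j) = 0\<^sub>v (card ?J)"
      using least_squares_normal_equation[OF B y arg_min] transpose_submatrix_UNIV_mult_vec[OF A J r'c]
      by (simp add: r' Bdef)
    then show ?thesis using p by (metis index_vec index_zero_vec(1))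
  qed
  ultimately show ?case using kK \<Lambda>' hits u' by auto
qed

text \<open>The transition system cannot get stuck: a selection exists because there are at least
  \<open>N\<close> blocks, and the enlarged set is small enough for the RIP to make its columns
  independent, so the estimate exists.\<close>

lemma exists_bommp_step:
  fixes A :: "real mat"
  assumes A: "A \<in> carrier_mat m (sum_list d)" and y: "y \<in> carrier_vec m"
    and RIP: "block_RIP_bound d A M \<delta>" and N: "N \<le> length d"
    and \<Lambda>: "\<Lambda> \<subseteq> {..<length d}" "card \<Lambda> + N \<le> M"
    and st: "bommp_state d A y K N \<epsilon> k \<Lambda> r" "bommp_continue A K N \<epsilon> k r"
  shows "\<exists>\<Lambda>' r'. bommp_state d A y K N \<epsilon> (Suc k) \<Lambda>' r'"
proof -
  obtain T where T: "largest_blocks d A N r T" using exists_largest_blocks[OF N] .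
  let ?\<Lambda> = "\<Lambda> \<union> T"
  let ?J = "block_indices d ?\<Lambda>" and ?n = "sum_list d"
  have \<Lambda>': "?\<Lambda> \<subseteq> {..<length d}" "card ?\<Lambda> \<le> M"
    using T \<Lambda> card_Un_le[of \<Lambda> T] by (auto simp: largest_blocks_def)
  have J: "?J \<subseteq> {..<?n}" using \<Lambda>' by (intro block_indices_subset)
  have Beq: "mat_blocks d A ?\<Lambda> = submatrix A UNIV ?J"
    by (simp add: mat_blocks_def block_indices_def)
  have B: "mat_blocks d A ?\<Lambda> \<in> carrier_mat m (card ?J)"
    unfolding Beq by (rule submatrix_UNIV_carrier[OF A J])
  have "u = 0\<^sub>v (card ?J)"
    if u: "u \<in> carrier_vec (card ?J)" and 0: "mat_blocks d A ?\<Lambda> *\<^sub>v u = 0\<^sub>v m" for u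
  proof (rule embed_vec_eq_0_imp[OF J u])
    show "embed_vec ?n ?J u = 0\<^sub>v ?n"
      using 0 submatrix_UNIV_mult_vec[OF A J u]
      by (intro block_RIP_bound_imp_inj[OF A RIP \<Lambda>' _ block_supp_embed_vec[OF \<Lambda>'(1)]])
         (auto simp: Beq embed_vec_def)
  qed
  then obtain z where
    "is_arg_min (\<lambda>u. vec_l2 (y - mat_blocks d A ?\<Lambda> *\<^sub>v u)) (\<lambda>u. u \<in> carrier_vec (card ?J)) z"
    using exists_least_squares[OF B y] by blast
  then show ?thesis
    using bommp_state.step[OF st T refl _ refl, of z] B by auto
qed

text \<open>A run stops either after \<open>K\<close> hits, which exhaust the support, or with zero
  residual, where injectivity identifies the current estimate with \<open>x\<close>. In both cases
  \<open>x\<close> is feasible for the output problem. Existence of an output is a separate claim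
  because the algorithm is a relation.\<close>

lemma bommp_exact_recovery:
  fixes A :: "real mat"
  assumes A: "A \<in> carrier_mat m (sum_list d)" and x: "x \<in> carrier_vec (sum_list d)"
    and RIP: "block_RIP_bound d A (N * K + 1) \<delta>" and sparse: "block_sparse d K x"
    and \<delta>: "\<delta> < 1 / sqrt (real K / real N + 1)" and N: "N > 0" "N \<le> length d" and K: "K > 0"
    and NK: "N * K \<le> m"
  shows "\<exists>xhat. bommp_output d A (A *\<^sub>v x) K N 0 xhat"
    and "bommp_output d A (A *\<^sub>v x) K N 0 xhat \<Longrightarrow> xhat = x"
proof -
  let ?y = "A *\<^sub>v x" and ?n = "sum_list d" and ?S = "block_supp d x"
  have y: "?y \<in> carrier_vec m" using A x by auto
  note inv = bommp_state_invariant[OF _ A x RIP sparse \<delta> N(1) K order_refl]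
  have SK: "card ?S \<le> K" using sparse by (simp add: block_sparse_def)
  have S: "?S \<subseteq> {..<length d}" by (rule block_supp_subset_lessThan)
  \<comment> \<open>As \<open>N * K \<le> m\<close>, the iteration limit is \<open>K\<close>, the
    number of hits that suffices.\<close>
  have min: "min (real K) (real (dim_row A) / real N) = K"
    using NK A N by (simp add: min_def field_simps flip: of_nat_mult)
  \<comment> \<open>Inclusion-exclusion, with the \<open>k\<close> hits counted once. Unlike in the
    selection step, \<open>k = K\<close> is allowed here.\<close>
  have card_Un: "card (?S \<union> \<Lambda>) \<le> N * K + 1"
    if kK: "k \<le> K" and "card \<Lambda> \<le> k * N" "k \<le> card (?S \<inter> \<Lambda>)" "\<Lambda> \<subseteq> {..<length d}" for k \<Lambda>
  proof -
    have fin: "finite \<Lambda>" using that finite_subset by blast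
    have "card (?S \<union> \<Lambda>) + card (?S \<inter> \<Lambda>) = card ?S + card \<Lambda>"
      using card_Un_Int[OF _ fin, of ?S] by simp
    then have "card (?S \<union> \<Lambda>) \<le> (K - k) + k * N" using that SK by linarith
    also have "\<dots> \<le> N * K + 1"
    proof -
      obtain e where "K = k + e" using le_Suc_ex[OF kK] by blast
      then show ?thesis using N by (cases N) (auto simp: algebra_simps)
    qed
    finally show ?thesis .
  qed
  have inj: "u = v" if "u \<in> carrier_vec ?n" "v \<in> carrier_vec ?n" "block_supp d u \<subseteq> \<Gamma>" "block_supp d v \<subseteq> \<Gamma>"
    "\<Gamma> \<subseteq> {..<length d}" "card \<Gamma> \<le> N * K + 1" "A *\<^sub>v (u - v) = 0\<^sub>v m" for u v \<Gamma>
  proof -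
    have "u - v = 0\<^sub>v ?n"
      using that by (intro block_RIP_bound_imp_inj[OF A RIP, of \<Gamma>] block_supp_diff) auto
    then have "u $ j - v $ j = 0" if "j < ?n" for j
      using that \<open>v \<in> _\<close> by (metis carrier_vecD index_minus_vec(1) index_zero_vec(1))
    then show ?thesis using that by (intro eq_vecI) auto
  qed
  have found: "?S \<subseteq> \<Lambda>"
    if st: "bommp_state d A ?y K N 0 k \<Lambda> r" "\<not> bommp_continue A K N 0 k r" for k \<Lambda> r
  proof -
    obtain u where I: "k \<le> K" "\<Lambda> \<subseteq> {..<length d}" "card \<Lambda> \<le> k * N" "k \<le> card (?S \<inter> \<Lambda>)"
      and u: "u \<in> carrier_vec ?n" "block_supp d u \<subseteq> \<Lambda>" "r = A *\<^sub>v (x - u)"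
      using inv[OF st(1)] by blast
    show ?thesis
    proof (cases "vec_l2 r > 0")
      case True
      then have "K \<le> card (?S \<inter> \<Lambda>)" using st(2) min I by (simp add: bommp_continue_def)
      then have "?S \<inter> \<Lambda> = ?S" using SK by (intro card_seteq) auto
      then show ?thesis by blast
    next
      case False
      then have "r \<bullet> r = 0" using vec_l2_nonneg[of r] vec_l2_power2[of r] by auto
      moreover have "r \<in> carrier_vec m" using A x u by auto
      ultimately have "A *\<^sub>v (x - u) = 0\<^sub>v m" using u scalar_prod_self_eq_0_iff by blast
      then have "x = u"
        using u S I card_Un by (intro inj[OF x u(1), of "?S \<union> \<Lambda>"]) auto
      then show ?thesis using u by simp
    qed
  qed
  have yy: "vec_l2 (?y - ?y) = 0" using y by (auto simp: vec_l2_def L2_set_def)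
  show "xhat = x" if out: "bommp_output d A ?y K N 0 xhat"
  proof -
    obtain k \<Lambda> r where st: "bommp_state d A ?y K N 0 k \<Lambda> r" "\<not> bommp_continue A K N 0 k r"
      and arg_min: "is_arg_min (\<lambda>u. vec_l2 (?y - A *\<^sub>v u))
        (\<lambda>u. u \<in> carrier_vec ?n \<and> block_supp d u \<subseteq> \<Lambda>) xhat"
      using out by (auto simp: bommp_output_def)
    have I: "k \<le> K" "\<Lambda> \<subseteq> {..<length d}" "card \<Lambda> \<le> k * N" "k \<le> card (?S \<inter> \<Lambda>)"
      using inv[OF st(1)] by auto
    have sub: "?S \<subseteq> \<Lambda>" by (rule found[OF st])
    \<comment> \<open>The signal \<open>x\<close> is a competitor because its support lies in
      \<open>\<Lambda>\<close>; its residual is zero, so the minimum is zero as well.\<close>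
    have xh: "xhat \<in> carrier_vec ?n" "block_supp d xhat \<subseteq> \<Lambda>"
      and le: "vec_l2 (?y - A *\<^sub>v xhat) \<le> vec_l2 (?y - ?y)"
      using arg_min x sub by (auto simp: is_arg_min_linorder)
    have eq: "?y - A *\<^sub>v xhat = A *\<^sub>v (x - xhat)"
      using mult_minus_distrib_mat_vec[OF A x xh(1)] by simp
    have c: "A *\<^sub>v (x - xhat) \<in> carrier_vec m" using A x xh by auto
    have "vec_l2 (A *\<^sub>v (x - xhat)) = 0" using le yy eq vec_l2_nonneg by (metis antisym)
    then have "A *\<^sub>v (x - xhat) = 0\<^sub>v m"
      using scalar_prod_self_eq_0_iff[OF c] vec_l2_power2 by (metis zero_power2)
    moreover have "card \<Lambda> \<le> N * K + 1" using card_Un[OF I(1) I(3,4,2)] sub by (simp add: Un_absorb1)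
    ultimately show ?thesis using inj[OF x xh(1) sub xh(2) I(2)] by simp
  qed
  have "\<exists>k \<Lambda> r. bommp_state d A ?y K N 0 k \<Lambda> r \<and> \<not> bommp_continue A K N 0 k r"
  \<comment> \<open>If every reachable state could continue, runs of any length would exist; one of
    length \<open>Suc K\<close> contradicts the invariant.\<close>
  proof (rule ccontr)
    assume none: "\<nexists>k \<Lambda> r. bommp_state d A ?y K N 0 k \<Lambda> r \<and> \<not> bommp_continue A K N 0 k r"
    have "\<exists>\<Lambda> r. bommp_state d A ?y K N 0 k \<Lambda> r" for k
    proof (induction k)
      case 0
      show ?case using bommp_state.init by blast
    next
      case (Suc k)
      then obtain \<Lambda> r where st: "bommp_state d A ?y K N 0 k \<Lambda> r" by blast
      with none have cont: "bommp_continue A K N 0 k r" by blast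
      then have "k < K" using min by (simp add: bommp_continue_def)
      then have "Suc k * N \<le> K * N" by (intro mult_le_mono1) simp
      then have "card \<Lambda> + N \<le> N * K + 1" using inv[OF st] by (simp add: mult.commute)
      then show ?case using exists_bommp_step[OF A y RIP N(2) _ _ st cont] inv[OF st] by blast
    qed
    then obtain \<Lambda> r where "bommp_state d A ?y K N 0 (Suc K) \<Lambda> r" by blast
    from inv[OF this] show False by simp
  qed
  then obtain k \<Lambda> r where st: "bommp_state d A ?y K N 0 k \<Lambda> r" "\<not> bommp_continue A K N 0 k r"
    by blast
  have "is_arg_min (\<lambda>u. vec_l2 (?y - A *\<^sub>v u)) (\<lambda>u. u \<in> carrier_vec ?n \<and> block_supp d u \<subseteq> \<Lambda>) x"
    using x found[OF st] yy by (simp add: is_arg_min_linorder)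
  then show "\<exists>xhat. bommp_output d A ?y K N 0 xhat"
    using st by (auto simp: bommp_output_def)
qed

theorem theorem3p3:
  fixes d :: "nat list" and m n l K N :: nat
    and A :: "real mat" and x :: "real vec"
  assumes "\<forall>i < l. d ! i > 0"
    and "length d = l"
    and "n = sum_list d"
    and "A \<in> carrier_mat m n"
    and "x \<in> carrier_vec n"
    and "block_sparse d K x"
    and "1 \<le> N" and "N \<le> K" and "real N \<le> real m / real K" and "N \<le> l"
    and "block_RIP d A (N * K + 1)"
    and "block_RIC d A (N * K + 1) < 1 / sqrt (real K / real N + 1)"
  shows "(\<exists>xhat. bommp_output d A (A *\<^sub>v x) K N 0 xhat) \<and>
         (\<forall>xhat. bommp_output d A (A *\<^sub>v x) K N 0 xhat \<longrightarrow> xhat = x)"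
proof -
  have K: "K > 0" using assms by simp
  have "real (N * K) \<le> real m" using assms(9) K by (simp add: field_simps)
  then have NK: "N * K \<le> m" by (simp only: of_nat_le_iff)
  have A: "A \<in> carrier_mat m (sum_list d)" and x: "x \<in> carrier_vec (sum_list d)"
    and N: "N > 0" "N \<le> length d"
    using assms by auto
  note * = bommp_exact_recovery[OF A x block_RIP_bound_block_RIC[OF assms(11)] assms(6,12) N K NK]
  show ?thesis using * by blast
qed

end
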